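(* Let $\lambda$ be a real number and let $\{a_n\}_{n\ge0}$, $\{A_n\}_{n\ge0}$ be sequences. (i) If $\{a_n\}$ and $\{A_n\}$ are both even sequences, or both odd sequences, then $$\sum_{k=0}^{2n+1}\binom{2n-\lambda}{2n+1-k}\binom{\lambda}{k}a_{2n+1-k}A_k=0\quad(n=0,1,2,\ldots).$$ (ii) If $\{a_n\}$ is an even sequence and $\{A_n\}$ is an odd sequence, then $$\sum_{k=0}^{2n}\binom{2n-1-\lambda}{2n-k}\binom{\lambda}{k}a_{2n-k}A_k=0\quad(n=0,1,2,\ldots).$$
   Context: A sequence $\{a_n\}_{n\ge0}$ of real (or complex) numbers is called an even sequence if $\sum_{k=0}^n\binom nk(-1)^ka_k=a_n$ for all $n=0,1,2,\ldots$, and an odd sequence if $\sum_{k=0}^n\binom nk(-1)^ka_k=-a_n$ for all $n=0,1,2,\ldots$. For real $x$ and a nonnegative integer $k$, $\binom xk=x(x-1)\cdots(x-k+1)/k!$ (with $\binom x0=1$). *)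

theory Defs
  imports Complex_Main
begin

text \<open>
  Sequences are real or complex. Both cases are covered by the class
  \<open>real_normed_field\<close>: its norm is multiplicative, so its instances are, up to isomorphism,
  exactly the real and the complex numbers.
\<close>

definition even_sequence :: "(nat \<Rightarrow> 'a::real_normed_field) \<Rightarrow> bool" where
  "even_sequence a \<longleftrightarrow> (\<forall>n. (\<Sum>k=0..n. of_nat (n choose k) * (- 1) ^ k * a k) = a n)"

definition odd_sequence :: "(nat \<Rightarrow> 'a::real_normed_field) \<Rightarrow> bool" where
  "odd_sequence a \<longleftrightarrow> (\<forall>n. (\<Sum>k=0..n. of_nat (n choose k) * (- 1) ^ k * a k) = - a n)"

end

theory Submission
  imports Defs "HOL-Computational_Algebra.Formal_Power_Series"
begin

text \<open>
  Let \<open>a\<^sup>*\<close> denote the binomial transform of \<open>a\<close>, and \<open>S N a A\<close> the convolution in the theorem with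
  upper index \<open>N\<close>. The point is the identity \<open>S N a\<^sup>* A\<^sup>* = (- 1) ^ N * S N a A\<close>: expanding both
  transforms, trinomial revision and Vandermonde's convolution give the coefficient of \<open>a i * A j\<close>
  the factor \<open>(m - 1) gchoose m\<close> with \<open>m = N - i - j\<close>, which vanishes unless \<open>m = 0\<close>. For eigenvectors
  of the transform whose signs multiply to \<open>- (- 1) ^ N\<close> the identity reads \<open>S = - S\<close>.
\<close>

definition binomial_transform :: "(nat \<Rightarrow> 'a::comm_ring_1) \<Rightarrow> nat \<Rightarrow> 'a" where
  "binomial_transform a n = (\<Sum>k=0..n. of_nat (n choose k) * (- 1) ^ k * a k)"

text \<open>The two upper indices add up to \<open>N - 1\<close>. Taking
  \<open>N = 2 * n + 1\<close> and \<open>N = 2 * n\<close> yields the two sums of the theorem, so a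
  single identity serves both.\<close>

definition gbinomial_convolution ::
    "real \<Rightarrow> nat \<Rightarrow> (nat \<Rightarrow> 'a) \<Rightarrow> (nat \<Rightarrow> 'a) \<Rightarrow> 'a::real_normed_field" where
  "gbinomial_convolution x N a A =
     (\<Sum>k=0..N. of_real (((real N - 1 - x) gchoose (N - k)) * (x gchoose k)) * a (N - k) * A k)"

text \<open>The added terms vanish because \<open>n choose k\<close> is 0 for \<open>k > n\<close>.
  A range that does not depend on \<open>n\<close> lets the summations be interchanged
  later.\<close>

lemma binomial_transform_extend:
  assumes "n \<le> N"
  shows "binomial_transform a n = (\<Sum>k=0..N. of_nat (n choose k) * (- 1) ^ k * a k)"
  unfolding binomial_transform_def
  by (rule sum.mono_neutral_left) (use assms in \<open>auto simp: binomial_eq_0\<close>)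

text \<open>For \<open>m > 0\<close> the upper index is the natural number \<open>m - 1\<close>,
  smaller than \<open>m\<close>. For \<open>m = 0\<close> it is -1, but any upper index over 0 gives
  1.\<close>

lemma gbinomial_minus_one_self:
  "((of_nat m - 1 :: 'a::field_char_0) gchoose m) = (if m = 0 then 1 else 0)"
proof (cases m)
  case (Suc l)
  then have "((of_nat m - 1 :: 'a) gchoose m) = of_nat l gchoose m" by simp
  also have "\<dots> = of_nat (l choose m)" by (simp add: binomial_gbinomial)
  finally show ?thesis using Suc by simp
qed simp

text \<open>Up to the sign \<open>(- 1) ^ (i + j)\<close>, this is the coefficient of
  \<open>a i * A j\<close> once both transforms in the convolution are expanded.\<close>

lemma gbinomial_convolution_coeff:
  fixes x :: "'a::field_char_0"
  shows "(\<Sum>k=0..N. ((of_nat N - 1 - x) gchoose (N - k)) * (x gchoose k) *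
             of_nat ((N - k) choose i) * of_nat (k choose j)) =
         (if i + j = N then ((of_nat N - 1 - x) gchoose i) * (x gchoose j) else 0)"
    (is "sum ?f _ = _")
proof (cases "i + j \<le> N")
  case False
  \<comment> \<open>If \<open>j \<le> k\<close>, then \<open>N - k \<le> N - j < i\<close>, so the
    other binomial vanishes.\<close>
  then have "?f k = 0" if "k \<in> {0..N}" for k
    using False that by (cases "k < j") (auto simp: binomial_eq_0)
  then have "sum ?f {0..N} = 0" by (intro sum.neutral) blast
  then show ?thesis using False by simp
next
  case True
  define m where "m = N - i - j"
  have N: "N = i + j + m" using True by (simp add: m_def)
  let ?y = "of_nat N - 1 - x"
  \<comment> \<open>Only \<open>j \<le> k \<le> N - i\<close> contributes, and
    \<open>N - i = m + j\<close>.\<close>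
  have "sum ?f {0..N} = sum ?f {0 + j..m + j}"
    by (rule sum.mono_neutral_right) (auto simp: N binomial_eq_0 not_le)
  also have "\<dots> = (\<Sum>k=0..m. ?f (k + j))"
    by (rule sum.shift_bounds_cl_nat_ivl)
  also have "\<dots> = (\<Sum>k=0..m. (?y gchoose i) * (x gchoose j) *
      (((x - of_nat j) gchoose k) * ((?y - of_nat i) gchoose (m - k))))"
  proof (rule sum.cong)
    fix k assume "k \<in> {0..m}"
    then have k: "N - (k + j) = m - k + i" by (simp add: N)
    have 1: "(x gchoose (k + j)) * of_nat ((k + j) choose j) =
        (x gchoose j) * ((x - of_nat j) gchoose k)"
      using gbinomial_trinomial_revision[of j "k + j" x] by (simp add: binomial_gbinomial)
    have 2: "(?y gchoose (m - k + i)) * of_nat ((m - k + i) choose i) =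
        (?y gchoose i) * ((?y - of_nat i) gchoose (m - k))"
      using gbinomial_trinomial_revision[of i "m - k + i" ?y] by (simp add: binomial_gbinomial)
    show "?f (k + j) = (?y gchoose i) * (x gchoose j) *
      (((x - of_nat j) gchoose k) * ((?y - of_nat i) gchoose (m - k)))"
      using arg_cong2[OF 1 2, of "(*)"] by (simp only: k mult_ac)
  qed simp
  also have "\<dots> = (?y gchoose i) * (x gchoose j) *
      ((x - of_nat j + (?y - of_nat i)) gchoose m)"
    by (simp only: sum_distrib_left[symmetric] gbinomial_Vandermonde)
  \<comment> \<open>Here \<open>x\<close> cancels: the upper index is
    \<open>N - 1 - i - j\<close>.\<close>
  also have "x - of_nat j + (?y - of_nat i) = of_nat m - 1" by (simp add: N)
  finally show ?thesis by (simp add: gbinomial_minus_one_self N)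
qed

lemma gbinomial_convolution_binomial_transform:
  fixes a A :: "nat \<Rightarrow> 'a::real_normed_field"
  shows "gbinomial_convolution x N (binomial_transform a) (binomial_transform A) =
         (- 1) ^ N * gbinomial_convolution x N a A"
proof -
  let ?c = "\<lambda>k. ((real N - 1 - x) gchoose (N - k)) * (x gchoose k)"
  let ?p = "\<lambda>i j. ((real N - 1 - x) gchoose i) * (x gchoose j)"
  have "gbinomial_convolution x N (binomial_transform a) (binomial_transform A) =
      (\<Sum>k=0..N. of_real (?c k) *
        (\<Sum>i=0..N. of_nat ((N - k) choose i) * (- 1) ^ i * a i) *
        (\<Sum>j=0..N. of_nat (k choose j) * (- 1) ^ j * A j))"
    unfolding gbinomial_convolution_def
    by (intro sum.cong refl arg_cong2[of _ _ _ _ "(*)"] binomial_transform_extend) auto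
  also have "\<dots> = (\<Sum>k=0..N. \<Sum>i=0..N. \<Sum>j=0..N. (- 1) ^ (i + j) * a i * A j *
      of_real (?c k * of_nat ((N - k) choose i) * of_nat (k choose j)))"
    by (simp only: sum_distrib_left sum_distrib_right of_real_mult of_real_of_nat_eq power_add
        mult_ac)
  also have "\<dots> = (\<Sum>i=0..N. \<Sum>k=0..N. \<Sum>j=0..N. (- 1) ^ (i + j) * a i * A j *
      of_real (?c k * of_nat ((N - k) choose i) * of_nat (k choose j)))"
    by (rule sum.swap)
  also have "\<dots> = (\<Sum>i=0..N. \<Sum>j=0..N. \<Sum>k=0..N. (- 1) ^ (i + j) * a i * A j *
      of_real (?c k * of_nat ((N - k) choose i) * of_nat (k choose j)))"
    by (rule sum.cong[OF refl], rule sum.swap)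
  also have "\<dots> = (\<Sum>i=0..N. \<Sum>j=0..N. (- 1) ^ (i + j) * a i * A j *
      of_real (if i + j = N then ?p i j else 0))"
    by (simp only: sum_distrib_left[symmetric] of_real_sum[symmetric] gbinomial_convolution_coeff)
  also have "\<dots> = (\<Sum>j=0..N. \<Sum>i=0..N. (- 1) ^ (i + j) * a i * A j *
      of_real (if i + j = N then ?p i j else 0))"
    by (rule sum.swap)
  \<comment> \<open>For each \<open>j\<close> only \<open>i = N - j\<close> survives, where the sign
    is \<open>(- 1) ^ N\<close>.\<close>
  also have "\<dots> = (\<Sum>j=0..N. (- 1) ^ N * (of_real (?p (N - j) j) * a (N - j) * A j))"
  proof (rule sum.cong)
    fix j assume "j \<in> {0..N}"
    then have "(\<Sum>i=0..N. (- 1) ^ (i + j) * a i * A j * of_real (if i + j = N then ?p i j else 0)) =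
        (\<Sum>i=0..N. if i = N - j then (- 1) ^ N * (of_real (?p i j) * a i * A j) else 0)"
      by (intro sum.cong) auto
    then show "(\<Sum>i=0..N. (- 1) ^ (i + j) * a i * A j * of_real (if i + j = N then ?p i j else 0)) =
        (- 1) ^ N * (of_real (?p (N - j) j) * a (N - j) * A j)"
      by simp
  qed simp
  finally show ?thesis
    by (simp only: gbinomial_convolution_def sum_distrib_left)
qed

lemma gbinomial_convolution_eq_0:
  fixes a A :: "nat \<Rightarrow> 'a::real_normed_field"
  assumes "binomial_transform a = (\<lambda>n. s * a n)" "binomial_transform A = (\<lambda>n. t * A n)"
    and "s * t = - ((- 1) ^ N)"
  shows "gbinomial_convolution x N a A = 0"
proof -
  let ?S = "gbinomial_convolution x N a A"
  have "(- 1) ^ N * ?S = gbinomial_convolution x N (\<lambda>n. s * a n) (\<lambda>n. t * A n)"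
    unfolding gbinomial_convolution_binomial_transform[symmetric] assms(1,2) ..
  also have "\<dots> = s * t * ?S"
    unfolding gbinomial_convolution_def sum_distrib_left by (rule sum.cong) (simp_all only: mult_ac)
  also have "\<dots> = - ((- 1) ^ N * ?S)"
    unfolding assms(3) by (rule mult_minus_left)
  finally show ?thesis
    \<comment> \<open>Either parity leaves \<open>?S = - ?S\<close>, which forces 0 in
      characteristic 0.\<close>
    by (cases "even N") simp_all
qed

text \<open>The explicit factor 1 matches the eigenvalue pattern \<open>s * a n\<close> of
  \<open>gbinomial_convolution_eq_0\<close>.\<close>

lemma even_sequence_binomial_transform:
  "even_sequence a \<longleftrightarrow> binomial_transform a = (\<lambda>n. 1 * a n)"
  by (simp add: even_sequence_def binomial_transform_def fun_eq_iff)

lemma odd_sequence_binomial_transform: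
  "odd_sequence a \<longleftrightarrow> binomial_transform a = (\<lambda>n. - 1 * a n)"
  by (simp add: odd_sequence_def binomial_transform_def fun_eq_iff)

theorem theorem2p7:
  fixes lam :: real and a A :: "nat \<Rightarrow> 'a::real_normed_field"
  shows "(even_sequence a \<and> even_sequence A \<or> odd_sequence a \<and> odd_sequence A \<longrightarrow>
           (\<forall>n::nat. (\<Sum>k=0..2*n+1.
              of_real (((2 * real n - lam) gchoose (2*n+1-k)) * (lam gchoose k))
                * a (2*n+1-k) * A k) = 0))
       \<and> (even_sequence a \<and> odd_sequence A \<longrightarrow>
           (\<forall>n::nat. (\<Sum>k=0..2*n.
              of_real (((2 * real n - 1 - lam) gchoose (2*n-k)) * (lam gchoose k))
                * a (2*n-k) * A k) = 0))"
proof (intro conjI impI allI)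
  fix n :: nat
  assume *: "even_sequence a \<and> even_sequence A \<or> odd_sequence a \<and> odd_sequence A"
  have "gbinomial_convolution lam (2 * n + 1) a A = 0"
    using *
  proof (elim disjE conjE)
    assume "even_sequence a" "even_sequence A"
    then show ?thesis
      unfolding even_sequence_binomial_transform by (rule gbinomial_convolution_eq_0) simp
  next
    assume "odd_sequence a" "odd_sequence A"
    then show ?thesis
      unfolding odd_sequence_binomial_transform by (rule gbinomial_convolution_eq_0) simp
  qed
  then show "(\<Sum>k=0..2*n+1. of_real (((2 * real n - lam) gchoose (2*n+1-k)) * (lam gchoose k))
      * a (2*n+1-k) * A k) = 0"
    by (simp add: gbinomial_convolution_def)
next
  fix n :: nat
  assume "even_sequence a \<and> odd_sequence A"
  then have "binomial_transform a = (\<lambda>n. 1 * a n)" "binomial_transform A = (\<lambda>n. - 1 * A n)"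
    by (simp_all only: even_sequence_binomial_transform odd_sequence_binomial_transform)
  then have "gbinomial_convolution lam (2 * n) a A = 0"
    \<comment> \<open>The eigenvalues 1 and -1 have product -1, as required for even
      \<open>N\<close>.\<close>
    by (rule gbinomial_convolution_eq_0) simp
  then show "(\<Sum>k=0..2*n. of_real (((2 * real n - 1 - lam) gchoose (2*n-k)) * (lam gchoose k))
      * a (2*n-k) * A k) = 0"
    by (simp add: gbinomial_convolution_def)
qed

end
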